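(* Let $X$ be a finite involutary quandle and $R$ an associative ring (not necessarily with unity). If $I$ is a two-sided ideal of $R[X]$ and $x_0,y_0\in X$ are in the same orbit under the action of $\mathrm{Inn}(X)$, then $X_{I,x_0}\cong X_{I,y_0}$ (as quandles), where $X_{I,z}=\{x\in X\mid x-z\in I\}$ for $z\in X$.
   Context: A quandle is a non-empty set $X$ with a binary operation $(x,y)\mapsto x.y$ such that: (R1) for all $x,y\in X$ there is a unique $z\in X$ with $x=z.y$; (R2) $(x.y).z=(x.z).(y.z)$ for all $x,y,z\in X$; (Q1) $x.x=x$ for all $x\in X$. For $x\in X$, $S_x:X\to X$ is the automorphism $S_x(y)=y.x$; $\mathrm{Inn}(X)$ is the group generated by all $S_x$, $x\in X$, acting on $X$ in the obvious way. $X$ is involutary if $S_x^2=\mathrm{id}_X$ for every $x\in X$. The quandle ring $R[X]$ is the set of formal finite $R$-linear combinations $\sum_i\alpha_i x_i$ ($\alpha_i\in R$, $x_i\in X$) with the usual addition and the (generally non-associative) multiplication $(\sum_i\alpha_i x_i).(\sum_j\beta_j x_j)=\sum_{i,j}\alpha_i\beta_j(x_i.x_j)$; elements of $X$ are regarded as elements of $R[X]$. A two-sided ideal of $R[X]$ is an additive subgroup closed under left and right multiplication by arbitrary elements of $R[X]$. For $X$ finite, each $X_{I,z}$ is a subquandle of $X$ (a quandle under the restricted operation).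
   Formalization: If R has no unity, points of X are not elements of R[X], so x−z∈I is undefined for x≠z; in that case X_{I,z} is taken to be {z}. For R with unity, X_{I,z} is {x∈X | 1x−1z∈I} as stated. *)

theory Defs
  imports "HOL-Library.Poly_Mapping" "HOL-Algebra.Bij" "HOL-Algebra.Group_Action"
    "HOL-Algebra.Generated_Groups"
begin

locale quandle =
  fixes X :: "'a set" and act :: "'a \<Rightarrow> 'a \<Rightarrow> 'a" (infixl "\<triangleleft>" 70)
  assumes nonempty: "X \<noteq> {}"
    and closed: "\<And>x y. x \<in> X \<Longrightarrow> y \<in> X \<Longrightarrow> x \<triangleleft> y \<in> X"
    and R1: "\<And>x y. x \<in> X \<Longrightarrow> y \<in> X \<Longrightarrow> \<exists>!z. z \<in> X \<and> x = z \<triangleleft> y"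
    and R2: "\<And>x y z. x \<in> X \<Longrightarrow> y \<in> X \<Longrightarrow> z \<in> X \<Longrightarrow>
               (x \<triangleleft> y) \<triangleleft> z = (x \<triangleleft> z) \<triangleleft> (y \<triangleleft> z)"
    and Q1: "\<And>x. x \<in> X \<Longrightarrow> x \<triangleleft> x = x"

definition quandle_isomorphic ::
  "'a set \<Rightarrow> ('a \<Rightarrow> 'a \<Rightarrow> 'a) \<Rightarrow> 'b set \<Rightarrow> ('b \<Rightarrow> 'b \<Rightarrow> 'b) \<Rightarrow> bool" where
  "quandle_isomorphic X actX Y actY \<longleftrightarrow>
     quandle X actX \<and> quandle Y actY \<and>
     (\<exists>f. bij_betw f X Y \<and> (\<forall>x\<in>X. \<forall>y\<in>X. f (actX x y) = actY (f x) (f y)))"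

text \<open>The map \<open>S\<^sub>x\<close>, made extensional on \<open>X\<close> so that it is an element of \<open>BijGroup X\<close>.\<close>

definition inner_map :: "'a set \<Rightarrow> ('a \<Rightarrow> 'a \<Rightarrow> 'a) \<Rightarrow> 'a \<Rightarrow> 'a \<Rightarrow> 'a" where
  "inner_map X act x = (\<lambda>y\<in>X. act y x)"

definition Inn :: "'a set \<Rightarrow> ('a \<Rightarrow> 'a \<Rightarrow> 'a) \<Rightarrow> ('a \<Rightarrow> 'a) monoid" where
  "Inn X act = (BijGroup X)\<lparr>carrier := generate (BijGroup X) (inner_map X act ` X)\<rparr>"

definition involutary :: "'a set \<Rightarrow> ('a \<Rightarrow> 'a \<Rightarrow> 'a) \<Rightarrow> bool" where
  "involutary X act \<longleftrightarrow>
     (\<forall>x\<in>X. compose X (inner_map X act x) (inner_map X act x) = (\<lambda>y\<in>X. y))"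

text \<open>Elements of \<open>R[X]\<close> are finitely supported functions with support in \<open>X\<close>. The ring \<open>R\<close> is
  the type \<open>'r\<close>; the class \<open>ring\<close> demands associativity but neither commutativity nor a unity.\<close>

definition quandle_ring :: "'a set \<Rightarrow> ('a \<Rightarrow>\<^sub>0 'r::ring) set" where
  "quandle_ring X = {p. Poly_Mapping.keys p \<subseteq> X}"

definition quandle_ring_mult ::
  "('a \<Rightarrow> 'a \<Rightarrow> 'a) \<Rightarrow> ('a \<Rightarrow>\<^sub>0 'r::ring) \<Rightarrow> ('a \<Rightarrow>\<^sub>0 'r) \<Rightarrow> ('a \<Rightarrow>\<^sub>0 'r)" where
  "quandle_ring_mult act p q =
     (\<Sum>x\<in>Poly_Mapping.keys p. \<Sum>y\<in>Poly_Mapping.keys q.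
        Poly_Mapping.single (act x y) (Poly_Mapping.lookup p x * Poly_Mapping.lookup q y))"

definition two_sided_ideal ::
  "'a set \<Rightarrow> ('a \<Rightarrow> 'a \<Rightarrow> 'a) \<Rightarrow> ('a \<Rightarrow>\<^sub>0 'r::ring) set \<Rightarrow> bool" where
  "two_sided_ideal X act I \<longleftrightarrow>
     I \<subseteq> quandle_ring X \<and> 0 \<in> I \<and> (\<forall>p\<in>I. \<forall>q\<in>I. p + q \<in> I) \<and> (\<forall>p\<in>I. - p \<in> I) \<and>
     (\<forall>p\<in>I. \<forall>q\<in>quandle_ring X. quandle_ring_mult act p q \<in> I \<and> quandle_ring_mult act q p \<in> I)"

definition is_unity :: "'r::ring \<Rightarrow> bool" where
  "is_unity e \<longleftrightarrow> (\<forall>r. e * r = r \<and> r * e = r)"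

text \<open>The set \<open>X\<^bsub>I,z\<^esub> = {x \<in> X | x - z \<in> I}\<close>. A point \<open>x\<close> is an element of \<open>R[X]\<close> as \<open>e x\<close> with
  \<open>e\<close> the unity of \<open>R\<close>. If \<open>R\<close> has no unity, the formal difference \<open>x - z\<close> has coefficients in \<open>R\<close>
  only when \<open>x = z\<close>, where it is \<open>0\<close>; hence the first disjunct, which is redundant (for an ideal
  \<open>I\<close>) when \<open>R\<close> has a unity: see the lemma below.\<close>

definition ideal_fibre :: "'a set \<Rightarrow> ('a \<Rightarrow>\<^sub>0 'r::ring) set \<Rightarrow> 'a \<Rightarrow> 'a set" where
  "ideal_fibre X I z =
     {x \<in> X. x = z \<or>
        (\<exists>e. is_unity e \<and> Poly_Mapping.single x e - Poly_Mapping.single z e \<in> I)}"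

lemma ideal_fibre_unity:
  fixes I :: "('a \<Rightarrow>\<^sub>0 'r::ring) set"
  assumes "two_sided_ideal X act I" and e: "is_unity (e :: 'r)"
  shows "ideal_fibre X I z =
           {x \<in> X. Poly_Mapping.single x e - Poly_Mapping.single z e \<in> I}"
proof -
  have "(\<exists>e'. is_unity e' \<and> P e') \<longleftrightarrow> P e" for P :: "'r \<Rightarrow> bool"
    using e unfolding is_unity_def by metis
  moreover have "0 \<in> I"
    using assms(1) by (simp add: two_sided_ideal_def)
  ultimately show ?thesis
    unfolding ideal_fibre_def by auto
qed

end

(* Right multiplication by a point u of X maps a difference x - z in I to x.u - z.u in I, so S_u sends
   the fibre of z into the fibre of z.u; as S_u is an involution of X, it restricts to an isomorphism
   between these fibres. A general element of Inn(X) is a product of maps S_u. *)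

theory Submission
  imports Defs
begin

lemma quandle_isomorphic_refl:
  "quandle X act \<Longrightarrow> quandle_isomorphic X act X act"
  unfolding quandle_isomorphic_def by (auto intro!: exI[of _ "\<lambda>x. x"] bij_betw_byWitness)

lemma quandle_isomorphic_trans:
  assumes "quandle_isomorphic X actX Y actY" and "quandle_isomorphic Y actY Z actZ"
  shows "quandle_isomorphic X actX Z actZ"
proof -
  obtain f where f: "bij_betw f X Y" "\<forall>x\<in>X. \<forall>y\<in>X. f (actX x y) = actY (f x) (f y)"
    using assms(1) unfolding quandle_isomorphic_def by blast
  obtain g where g: "bij_betw g Y Z" "\<forall>x\<in>Y. \<forall>y\<in>Y. g (actY x y) = actZ (g x) (g y)"
    using assms(2) unfolding quandle_isomorphic_def by blast
  have "bij_betw (g \<circ> f) X Z"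
    using f(1) g(1) by (rule bij_betw_trans)
  moreover have "\<forall>x\<in>X. \<forall>y\<in>X. (g \<circ> f) (actX x y) = actZ ((g \<circ> f) x) ((g \<circ> f) y)"
    using f g by (simp add: bij_betw_apply)
  ultimately show ?thesis
    using assms unfolding quandle_isomorphic_def by blast
qed

text \<open>Indices outside the supports contribute zero terms. Fixed index sets make products
  computable when the exact support is unknown: a difference of two singles can have fewer keys than
  its two points, for instance when a coefficient vanishes.\<close>

lemma quandle_ring_mult_eq_sum:
  assumes "finite A" "Poly_Mapping.keys p \<subseteq> A" "finite B" "Poly_Mapping.keys q \<subseteq> B"
  shows "quandle_ring_mult act p q =
    (\<Sum>x\<in>A. \<Sum>y\<in>B.
       Poly_Mapping.single (act x y) (Poly_Mapping.lookup p x * Poly_Mapping.lookup q y))"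
proof -
  have "quandle_ring_mult act p q =
      (\<Sum>x\<in>Poly_Mapping.keys p. \<Sum>y\<in>B.
         Poly_Mapping.single (act x y) (Poly_Mapping.lookup p x * Poly_Mapping.lookup q y))"
    unfolding quandle_ring_mult_def
    by (intro sum.cong refl sum.mono_neutral_left) (use assms in \<open>auto simp: in_keys_iff\<close>)
  also have "\<dots> = (\<Sum>x\<in>A. \<Sum>y\<in>B.
       Poly_Mapping.single (act x y) (Poly_Mapping.lookup p x * Poly_Mapping.lookup q y))"
    by (intro sum.mono_neutral_left) (use assms in \<open>auto simp: in_keys_iff\<close>)
  finally show ?thesis .
qed

lemma keys_single_diff_single:
  fixes a b :: "'r::ring"
  shows "Poly_Mapping.keys (Poly_Mapping.single x a - Poly_Mapping.single z b) \<subseteq> {x, z}"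
  by (auto simp: in_keys_iff lookup_minus lookup_single when_def split: if_splits)

lemma quandle_ring_mult_diff_single:
  fixes a b :: "'r::ring"
  shows "quandle_ring_mult act (Poly_Mapping.single x a - Poly_Mapping.single z a)
           (Poly_Mapping.single u b) =
         Poly_Mapping.single (act x u) (a * b) - Poly_Mapping.single (act z u) (a * b)"
\<comment> \<open>For \<open>x = z\<close> the difference is 0 and \<open>{x, z}\<close> collapses
  to one point, so the expansion into two summands needs \<open>x \<noteq> z\<close>.\<close>
proof (cases "x = z")
  case True
  then show ?thesis by (simp add: quandle_ring_mult_def)
next
  case False
  then show ?thesis
    by (subst quandle_ring_mult_eq_sum[of "{x, z}" _ "{u}"])
      (simp_all add: keys_single_diff_single lookup_minus lookup_single when_def single_uminus)
qed

lemma quandle_ring_mult_single_diff: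
  fixes a b :: "'r::ring"
  shows "quandle_ring_mult act (Poly_Mapping.single u b)
           (Poly_Mapping.single x a - Poly_Mapping.single z a) =
         Poly_Mapping.single (act u x) (b * a) - Poly_Mapping.single (act u z) (b * a)"
proof (cases "x = z")
  case True
  then show ?thesis by (simp add: quandle_ring_mult_def)
next
  case False
  then show ?thesis
    by (subst quandle_ring_mult_eq_sum[of "{u}" _ "{x, z}"])
      (simp_all add: keys_single_diff_single lookup_minus lookup_single when_def single_uminus)
qed

locale involutary_quandle_ideal = quandle X act
  for X :: "'a set" and act :: "'a \<Rightarrow> 'a \<Rightarrow> 'a" (infixl "\<triangleleft>" 70) +
  fixes I :: "('a \<Rightarrow>\<^sub>0 'r::ring) set"
  assumes involutary: "involutary X act"
    and ideal: "two_sided_ideal X act I"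
begin

lemma act_act:
  assumes "x \<in> X" "y \<in> X"
  shows "(x \<triangleleft> y) \<triangleleft> y = x"
proof -
  have "compose X (inner_map X act y) (inner_map X act y) x = (\<lambda>y\<in>X. y) x"
    using involutary assms(2) by (simp add: involutary_def)
  then show ?thesis
    using assms closed by (simp add: compose_eq inner_map_def)
qed

lemma single_in_quandle_ring: "x \<in> X \<Longrightarrow> Poly_Mapping.single x r \<in> quandle_ring X"
  by (simp add: quandle_ring_def)

lemma ideal_fibre_subset: "ideal_fibre X I z \<subseteq> X"
  by (auto simp: ideal_fibre_def)

lemma ideal_fibre_self: "z \<in> X \<Longrightarrow> z \<in> ideal_fibre X I z"
  by (simp add: ideal_fibre_def)

text \<open>The differences telescope: \<open>(x - y) + (y - z) = x - z\<close>, and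
  \<open>I\<close> is closed under addition.\<close>

lemma ideal_fibre_trans:
  assumes "x \<in> ideal_fibre X I y" and "y \<in> ideal_fibre X I z"
  shows "x \<in> ideal_fibre X I z"
\<comment> \<open>With a unity, \<open>ideal_fibre_unity\<close> turns membership into a condition
  on one fixed \<open>e\<close>. Without one, only the disjunct \<open>x = z\<close> of the
  definition survives, so the fibre of a point of \<open>X\<close> is that point alone.\<close>
proof (cases "\<exists>e :: 'r. is_unity e")
  case True
  then obtain e :: 'r where e: "is_unity e" by blast
  have "(Poly_Mapping.single x e - Poly_Mapping.single y e) +
      (Poly_Mapping.single y e - Poly_Mapping.single z e) \<in> I"
    using assms ideal unfolding ideal_fibre_unity[OF ideal e] two_sided_ideal_def by blast
  then show ?thesis
    using assms(1) unfolding ideal_fibre_unity[OF ideal e] by simp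
next
  case False
  then show ?thesis
    using assms by (auto simp: ideal_fibre_def)
qed

lemma ideal_fibre_act_right:
  assumes "x \<in> ideal_fibre X I z" and "z \<in> X" and "u \<in> X"
  shows "x \<triangleleft> u \<in> ideal_fibre X I (z \<triangleleft> u)"
proof (cases "\<exists>e :: 'r. is_unity e")
  case True
  then obtain e :: 'r where e: "is_unity e" by blast
  \<comment> \<open>The product has coefficients \<open>e * e\<close>; idempotence turns it back
    into a difference of points.\<close>
  then have "e * e = e" by (simp add: is_unity_def)
  moreover have "quandle_ring_mult act (Poly_Mapping.single x e - Poly_Mapping.single z e)
      (Poly_Mapping.single u e) \<in> I"
    using assms ideal single_in_quandle_ring
    unfolding ideal_fibre_unity[OF ideal e] two_sided_ideal_def by blast
  ultimately show ?thesis
    using assms closed unfolding ideal_fibre_unity[OF ideal e]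
    by (simp add: quandle_ring_mult_diff_single)
next
  case False
  then show ?thesis
    using assms closed by (auto simp: ideal_fibre_def)
qed

text \<open>The mirror image, with \<open>I\<close> used as a left ideal. It serves to show that a
  fibre is closed under the operation.\<close>

lemma ideal_fibre_act_left:
  assumes "x \<in> ideal_fibre X I z" and "z \<in> X" and "u \<in> X"
  shows "u \<triangleleft> x \<in> ideal_fibre X I (u \<triangleleft> z)"
proof (cases "\<exists>e :: 'r. is_unity e")
  case True
  then obtain e :: 'r where e: "is_unity e" by blast
  then have "e * e = e" by (simp add: is_unity_def)
  moreover have "quandle_ring_mult act (Poly_Mapping.single u e)
      (Poly_Mapping.single x e - Poly_Mapping.single z e) \<in> I"
    using assms ideal single_in_quandle_ring
    unfolding ideal_fibre_unity[OF ideal e] two_sided_ideal_def by blast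
  ultimately show ?thesis
    using assms closed unfolding ideal_fibre_unity[OF ideal e]
    by (simp add: quandle_ring_mult_single_diff)
next
  case False
  then show ?thesis
    using assms closed by (auto simp: ideal_fibre_def)
qed

text \<open>Replace one factor at a time: \<open>x.y\<close> is congruent to \<open>z.y\<close>
  modulo \<open>I\<close>, and \<open>z.y\<close> to \<open>z.z\<close>, which is \<open>z\<close>
  by idempotence.\<close>

lemma ideal_fibre_closed:
  assumes "x \<in> ideal_fibre X I z" and "y \<in> ideal_fibre X I z" and "z \<in> X"
  shows "x \<triangleleft> y \<in> ideal_fibre X I z"
proof -
  have "x \<triangleleft> y \<in> ideal_fibre X I (z \<triangleleft> y)"
    using assms ideal_fibre_subset by (blast intro: ideal_fibre_act_right)
  moreover have "z \<triangleleft> y \<in> ideal_fibre X I (z \<triangleleft> z)"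
    using assms by (blast intro: ideal_fibre_act_left)
  ultimately show ?thesis
    using Q1[OF \<open>z \<in> X\<close>] ideal_fibre_trans by metis
qed

lemma quandle_ideal_fibre:
  assumes "z \<in> X"
  shows "quandle (ideal_fibre X I z) act"
proof
  show "ideal_fibre X I z \<noteq> {}"
    using ideal_fibre_self assms by blast
next
  fix x y assume xy: "x \<in> ideal_fibre X I z" "y \<in> ideal_fibre X I z"
  then have X: "x \<in> X" "y \<in> X"
    using ideal_fibre_subset by blast+
  show "x \<triangleleft> y \<in> ideal_fibre X I z"
    using xy assms by (rule ideal_fibre_closed)
  \<comment> \<open>Since \<open>S_y\<close> is its own inverse, the only solution of
    \<open>x = w.y\<close> is \<open>w = x.y\<close>, which was just shown to stay in the
    fibre.\<close>
  then show "\<exists>!w. w \<in> ideal_fibre X I z \<and> x = w \<triangleleft> y"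
    using X by (intro ex1I[of _ "x \<triangleleft> y"]) (auto simp: act_act ideal_fibre_subset[THEN subsetD])
qed (use ideal_fibre_subset R2 Q1 in \<open>blast+\<close>)

lemma quandle_isomorphic_ideal_fibre_act:
  assumes z: "z \<in> X" and u: "u \<in> X"
  shows "quandle_isomorphic (ideal_fibre X I z) act (ideal_fibre X I (z \<triangleleft> u)) act"
proof -
  have "bij_betw (\<lambda>y. y \<triangleleft> u) (ideal_fibre X I z) (ideal_fibre X I (z \<triangleleft> u))"
  proof (rule bij_betw_byWitness[where f' = "\<lambda>y. y \<triangleleft> u"])
    show "(\<lambda>y. y \<triangleleft> u) ` ideal_fibre X I z \<subseteq> ideal_fibre X I (z \<triangleleft> u)"
      using ideal_fibre_act_right z u by blast
    \<comment> \<open>The forward inclusion again, now based at \<open>z.u\<close>: its target is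
      the fibre of \<open>(z.u).u = z\<close>.\<close>
    show "(\<lambda>y. y \<triangleleft> u) ` ideal_fibre X I (z \<triangleleft> u) \<subseteq> ideal_fibre X I z"
      using ideal_fibre_act_right[of _ "z \<triangleleft> u" u] closed act_act z u by auto
  qed (use ideal_fibre_subset act_act u in blast)+
  moreover have "(x \<triangleleft> y) \<triangleleft> u = (x \<triangleleft> u) \<triangleleft> (y \<triangleleft> u)"
    if "x \<in> ideal_fibre X I z" "y \<in> ideal_fibre X I z" for x y
    using that ideal_fibre_subset u by (blast intro: R2)
  ultimately show ?thesis
    using quandle_ideal_fibre closed z u unfolding quandle_isomorphic_def by blast
qed

lemma inner_map_in_Bij:
  assumes "u \<in> X"
  shows "inner_map X act u \<in> carrier (BijGroup X)"
proof -
  have "bij_betw (\<lambda>y. y \<triangleleft> u) X X"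
    by (rule bij_betw_byWitness[where f' = "\<lambda>y. y \<triangleleft> u"]) (use act_act closed assms in auto)
  then show ?thesis
    by (simp add: BijGroup_def Bij_def inner_map_def cong: bij_betw_cong)
qed

text \<open>Involutarity says that \<open>S_u\<close> squares to the identity of
  \<open>BijGroup X\<close>. Inverses of generators are thus generators, and the induction over the
  generated group needs no new isomorphism for them.\<close>

lemma inv_inner_map:
  assumes "u \<in> X"
  shows "inv\<^bsub>BijGroup X\<^esub> (inner_map X act u) = inner_map X act u"
proof (rule group.inv_equality[OF group_BijGroup])
  show "inner_map X act u \<otimes>\<^bsub>BijGroup X\<^esub> inner_map X act u = \<one>\<^bsub>BijGroup X\<^esub>"
    using assms involutary inner_map_in_Bij[OF assms]
    by (simp add: BijGroup_def involutary_def)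
qed (use inner_map_in_Bij[OF assms] in simp_all)

text \<open>Induction on how \<open>g\<close> is generated. The base point \<open>z\<close> stays
  arbitrary because in a product \<open>h1 h2\<close> the hypothesis for \<open>h1\<close> is
  applied at \<open>h2 z\<close>.\<close>

lemma quandle_isomorphic_ideal_fibre_generate:
  assumes "g \<in> generate (BijGroup X) (inner_map X act ` X)" and "z \<in> X"
  shows "quandle_isomorphic (ideal_fibre X I z) act (ideal_fibre X I (g z)) act"
  using assms
proof (induction arbitrary: z rule: generate.induct)
  case one
  then show ?case
    by (simp add: BijGroup_def quandle_isomorphic_refl quandle_ideal_fibre)
next
  case (incl h)
  then show ?case
    using quandle_isomorphic_ideal_fibre_act by (auto simp: inner_map_def)
next
  case (inv h)
  then obtain u where "u \<in> X" and h: "h = inner_map X act u" by blast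
  then show ?case
    using inv.prems quandle_isomorphic_ideal_fibre_act
    \<comment> \<open>The inverse is removed first, while \<open>inner_map\<close> is still folded
      and \<open>inv_inner_map\<close> can match.\<close>
    by (simp only: h inv_inner_map) (simp add: inner_map_def)
next
  case (eng h1 h2)
  \<comment> \<open>Multiplication in \<open>BijGroup X\<close> is specified as composition only on
    \<open>Bij X\<close>, so both factors must be known to lie there.\<close>
  have "generate (BijGroup X) (inner_map X act ` X) \<subseteq> Bij X"
    using group.generate_incl[OF group_BijGroup, of "inner_map X act ` X" X] inner_map_in_Bij
    by (auto simp: BijGroup_def)
  then have Bij: "h1 \<in> Bij X" "h2 \<in> Bij X"
    using eng.hyps by blast+
  then have "h2 z \<in> X"
    using eng.prems Bij_imp_funcset by blast
  \<comment> \<open>The right factor acts first: the isomorphisms lead from the fibre of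
    \<open>z\<close> to that of \<open>h2 z\<close>, then to that of
    \<open>h1 (h2 z)\<close>.\<close>
  then show ?case
    using quandle_isomorphic_trans[OF eng.IH(2)[OF eng.prems] eng.IH(1)] Bij eng.prems
    by (simp add: BijGroup_def compose_eq)
qed

end

theorem theorem4p3:
  fixes X :: "'a set" and act :: "'a \<Rightarrow> 'a \<Rightarrow> 'a" and I :: "('a \<Rightarrow>\<^sub>0 'r::ring) set"
    and x0 y0 :: 'a
  assumes "quandle X act" and "finite X" and "involutary X act"
    and "two_sided_ideal X act I"
    and "x0 \<in> X" and "y0 \<in> X"
    and "y0 \<in> orbit (Inn X act) (\<lambda>g. g) x0"
  shows "quandle_isomorphic (ideal_fibre X I x0) act (ideal_fibre X I y0) act"
proof -
  interpret quandle X act by fact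
  interpret involutary_quandle_ideal X act I
    by unfold_locales fact+
  \<comment> \<open>Group elements are themselves maps on \<open>X\<close>, so a point of the orbit
    is the value at \<open>x0\<close> of some generated map.\<close>
  obtain g where "g \<in> generate (BijGroup X) (inner_map X act ` X)" and "y0 = g x0"
    using assms(7) by (auto simp: orbit_def Inn_def)
  then show ?thesis
    using quandle_isomorphic_ideal_fibre_generate \<open>x0 \<in> X\<close> by simp
qed

end
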